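(* Let $n\ge1$ be an integer and $a,b>0$. The collision sequence $(31)^n$ is allowed as a capture process for mass ratios $(a,b)$ if and only if $$ab\,\cot^2\!\left(\frac{(2n-1)\pi}{2(2n+1)}\right)-a-b-1\ \ge\ 0 .$$
   Context: Setting: three point particles 1, 2, 3 move in the plane, identified with $\mathbb{C}$, with masses $m_1,m_2,m_3>0$; put $a=m_1/m_2$, $b=m_3/m_2$. Between collisions particles move freely with constant velocity. A collision "$(i)$", $i\in\{1,2,3\}$, is a collision between the two particles other than $i$ (the spectator): the two particles are at the same position with nonzero relative velocity, and instantaneously their velocities change so that their total momentum is conserved and their relative velocity is multiplied by a complex number $x=e^{i\alpha}$, $|x|=1$ (so kinetic energy is conserved); the spectator's velocity is unchanged. The number $x$ (the scattering angle $\alpha$) may be any unit complex number and may be chosen independently at each collision. A collision sequence is written as a string in order of occurrence from left to right; $(31)^n$ is $(3)(1)(3)(1)\cdots(3)(1)$ with $2n$ collisions. The times between successive collisions are required to be strictly positive, and no other interactions occur. Capture process: initially particles 2 and 3 are at rest at distinct points, and particle 1 has a nonzero velocity. A collision sequence is allowed as a capture process for $(a,b)$ if there exist initial positions and velocity of particle 1, initial positions of 2 and 3, and scattering angles such that the collisions of the sequence occur in that order, and after the last collision particles 1 and 2 have equal velocities. *)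

theory Defs
  imports Complex_Main
begin

datatype particle = P1 | P2 | P3

record state =
  pos :: "particle \<Rightarrow> complex"
  vel :: "particle \<Rightarrow> complex"

definition drift :: "real \<Rightarrow> state \<Rightarrow> state" where
  "drift t s = s\<lparr>pos := (\<lambda>i. pos s i + of_real t * vel s i)\<rparr>"

definition meet :: "particle \<Rightarrow> particle \<Rightarrow> state \<Rightarrow> bool" where
  "meet j k s \<longleftrightarrow> j \<noteq> k \<and> pos s j = pos s k \<and> vel s j \<noteq> vel s k"

text \<open>
  A collision is named after its spectator \<open>i\<close>; \<open>s\<close> and \<open>s'\<close> are the states
  immediately before and after it, and \<open>x\<close> is the unit factor
  multiplying the relative velocity. The first conjunct makes the collision binary: the two
  particles other than \<open>i\<close> meet, and the spectator meets neither of them.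
\<close>

definition collision ::
    "(particle \<Rightarrow> real) \<Rightarrow> particle \<Rightarrow> complex \<Rightarrow> state \<Rightarrow> state \<Rightarrow> bool" where
  "collision m i x s s' \<longleftrightarrow>
     (\<forall>j k. meet j k s \<longleftrightarrow> j \<noteq> k \<and> j \<noteq> i \<and> k \<noteq> i) \<and>
     norm x = 1 \<and>
     pos s' = pos s \<and>
     vel s' i = vel s i \<and>
     (\<forall>j k. j \<noteq> k \<and> j \<noteq> i \<and> k \<noteq> i \<longrightarrow>
        of_real (m j) * vel s' j + of_real (m k) * vel s' k
          = of_real (m j) * vel s j + of_real (m k) * vel s k \<and>
        vel s' j - vel s' k = x * (vel s j - vel s k))"

text \<open>
  \<open>evolution m cs s s'\<close>: starting from \<open>s\<close>, the motion undergoes exactly the collisions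
  \<open>cs\<close>, in list order, and \<open>s'\<close> is the state immediately after the last of them.
  Since \<open>x = 1\<close> is a legal scattering factor, two particles passing through each other with
  unchanged velocities would be an (unlisted) collision; this is why meetings during the free
  flights are excluded.
\<close>

inductive evolution ::
    "(particle \<Rightarrow> real) \<Rightarrow> particle list \<Rightarrow> state \<Rightarrow> state \<Rightarrow> bool"
  for m :: "particle \<Rightarrow> real" where
  Nil: "evolution m [] s s"
| Cons: "\<lbrakk>0 < \<tau>; \<forall>t\<in>{0<..<\<tau>}. \<forall>j k. \<not> meet j k (drift t s);
          collision m i x (drift \<tau> s) s'; evolution m cs s' s''\<rbrakk>
         \<Longrightarrow> evolution m (i # cs) s s''"

definition capture_allowed :: "(particle \<Rightarrow> real) \<Rightarrow> particle list \<Rightarrow> bool" where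
  "capture_allowed m cs \<longleftrightarrow> (\<exists>s s'.
     vel s P2 = 0 \<and> vel s P3 = 0 \<and> pos s P2 \<noteq> pos s P3 \<and> vel s P1 \<noteq> 0 \<and>
     evolution m cs s s' \<and>
     (\<forall>t>0. \<forall>j k. \<not> meet j k (drift t s')) \<and>
     vel s' P1 = vel s' P2)"

end

(*
  Let u_k be the relative speed of the pair colliding at the k-th collision, let u_0 be the relative
  speed of the other pair before the first collision and u_(2n+1) that of the other pair after the
  last one. Since the next collision takes place on a complex line, the velocity of the
  non-colliding gap is a real multiple of that gap before and after each collision, with opposite
  signs. Conservation of momentum and energy then gives u_(k-1) + u_(k+1) = 2 c_i kappa u_k, where
  c_i depends on the masses of the colliding pair and kappa <= 1 is the cosine of an angle that is
  the same for all collisions. A capture means u_0 = u_(2n+1) = 0. After rescaling u_k by sqrt(c_i),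
  this is a discrete Sturm-Liouville problem with the positive solution sin (k pi / (2n+1)), so
  kappa sqrt(c_1 c_3) = cos (pi / (2n+1)). Such a kappa <= 1 exists exactly if
  cos (pi / (2n+1)) <= sqrt(c_1 c_3), and it is then realised by gaps whose phase turns by the
  fixed angle arccos kappa from one collision to the next.
*)

theory Submission
  imports Defs
begin

section \<open>The collision law in gap coordinates\<close>

text \<open>A gap is named, like a collision, after the spectator of the pair; the signs make both gaps
  point in the same direction when the particles are in the order 1, 2, 3 on a line.\<close>

definition gap :: "particle \<Rightarrow> (particle \<Rightarrow> complex) \<Rightarrow> complex" where
  "gap i f = (if i = P3 then f P2 - f P1 else f P3 - f P2)"

definition opp :: "particle \<Rightarrow> particle" where
  "opp i = (if i = P3 then P1 else P3)"

text \<open>The mass fraction locating the centre of mass of the colliding pair: for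
  \<open>i\<close> equal to \<open>P1\<close> or \<open>P3\<close>,
  \<open>gap (opp i) f + coef m i * gap i f\<close> is, up to sign, the spectator's offset from that
  centre.\<close>

definition coef :: "(particle \<Rightarrow> real) \<Rightarrow> particle \<Rightarrow> real" where
  "coef m i = m (opp i) / (m (opp i) + m P2)"

text \<open>Growing by single collisions rather than by pairs lets the inductions exchange the two
  gaps at each step.\<close>

fun alt :: "particle \<Rightarrow> nat \<Rightarrow> particle list" where
  "alt i 0 = []"
| "alt i (Suc r) = i # alt (opp i) r"

lemma opp_simps [simp]: "opp P3 = P1" "opp P1 = P3"
  by (simp_all add: opp_def)

lemma concat_replicate_eq_alt: "concat (replicate n [P3, P1]) = alt P3 (2 * n)"
  by (induction n) auto

lemma coef_pos:
  assumes "m P1 > 0" "m P2 > 0" "m P3 > 0"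
  shows "coef m i > 0"
  using assms by (cases i) (simp_all add: coef_def opp_def)

lemma gap_drift: "gap i (pos (drift t s)) = gap i (pos s) + of_real t * gap i (vel s)"
  by (simp add: gap_def drift_def algebra_simps)

lemma vel_drift [simp]: "vel (drift t s) = vel s"
  by (simp add: drift_def)

text \<open>The sum of the gaps separates particles 1 and 3, a pair that is never listed but could
  still meet in flight.\<close>

lemma no_meet:
  assumes "gap P1 (pos s) \<noteq> 0" "gap P3 (pos s) \<noteq> 0" "gap P1 (pos s) + gap P3 (pos s) \<noteq> 0"
  shows "\<not> meet j k s"
  using assms by (cases j; cases k) (auto simp: meet_def gap_def)

text \<open>Either side is minus the velocity of the pair's centre of mass.\<close>

lemma momentum_gap:
  fixes A B v w v' w' :: complex
  assumes "A * v' + B * w' = A * v + B * w" "A + B \<noteq> 0"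
  shows "A / (A + B) * (w' - v') - w' = A / (A + B) * (w - v) - w"
proof -
  have "A * (w' - v') - (A + B) * w' = A * (w - v) - (A + B) * w"
    using assms(1) by algebra
  then have "(A * (w' - v') - (A + B) * w') / (A + B) = (A * (w - v) - (A + B) * w) / (A + B)"
    by simp
  then show ?thesis using assms(2) by (simp add: diff_divide_distrib)
qed

lemma collisionD:
  assumes col: "collision m i x s s'" and i: "i = P1 \<or> i = P3"
    and m: "m P1 > 0" "m P2 > 0" "m P3 > 0"
  shows "gap i (pos s) = 0" "gap i (vel s) \<noteq> 0" "gap (opp i) (pos s) \<noteq> 0" "pos s' = pos s"
    "norm (gap i (vel s')) = norm (gap i (vel s))"
    "gap (opp i) (vel s') + of_real (coef m i) * gap i (vel s')
      = gap (opp i) (vel s) + of_real (coef m i) * gap i (vel s)"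
proof -
  have mt: "\<And>j k. meet j k s \<longleftrightarrow> j \<noteq> k \<and> j \<noteq> i \<and> k \<noteq> i" and x: "norm x = 1"
    and p: "pos s' = pos s" and vi: "vel s' i = vel s i"
    and c: "\<And>j k. j \<noteq> k \<Longrightarrow> j \<noteq> i \<Longrightarrow> k \<noteq> i \<Longrightarrow>
        of_real (m j) * vel s' j + of_real (m k) * vel s' k
          = of_real (m j) * vel s j + of_real (m k) * vel s k \<and>
        vel s' j - vel s' k = x * (vel s j - vel s k)"
    using col unfolding collision_def by blast+
  show "pos s' = pos s" by (fact p)
  show g: "gap i (pos s) = 0" "gap i (vel s) \<noteq> 0"
    using mt[of P1 P2] mt[of P2 P3] i by (auto simp: meet_def gap_def)
  show "gap (opp i) (pos s) \<noteq> 0"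
    using mt[of P1 P2] mt[of P2 P3] mt[of P1 P3] i
    by (auto simp: meet_def gap_def opp_def split: if_splits)
  have gx: "gap i (vel s') = x * gap i (vel s)"
    using c[of P2 P1] c[of P3 P2] i by (auto simp: gap_def)
  then show "norm (gap i (vel s')) = norm (gap i (vel s))"
    by (simp add: norm_mult x)
  show "gap (opp i) (vel s') + of_real (coef m i) * gap i (vel s')
      = gap (opp i) (vel s) + of_real (coef m i) * gap i (vel s)"
  proof (cases "i = P3")
    case True
    have "complex_of_real (m P1) + of_real (m P2) \<noteq> 0"
      using m by (metis add_pos_pos less_irrefl of_real_0 of_real_add of_real_eq_iff)
    moreover have "of_real (m P1) * vel s' P1 + of_real (m P2) * vel s' P2
          = of_real (m P1) * vel s P1 + of_real (m P2) * vel s P2"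
      using c[of P1 P2] True by simp
    ultimately show ?thesis using True vi
      using momentum_gap[of "of_real (m P1)" "vel s' P1" "of_real (m P2)" "vel s' P2" "vel s P1" "vel s P2"]
      by (simp add: gap_def coef_def)
  next
    case False
    then have i1: "i = P1" using i by simp
    have "complex_of_real (m P3) + of_real (m P2) \<noteq> 0"
      using m by (metis add_pos_pos less_irrefl of_real_0 of_real_add of_real_eq_iff)
    moreover have "of_real (m P3) * vel s' P3 + of_real (m P2) * vel s' P2
          = of_real (m P3) * vel s P3 + of_real (m P2) * vel s P2"
      using c[of P3 P2] i1 by simp
    ultimately have "of_real (coef m P1) * (vel s' P2 - vel s' P3) - vel s' P2
        = of_real (coef m P1) * (vel s P2 - vel s P3) - vel s P2"
      using momentum_gap[of "of_real (m P3)" "vel s' P3" "of_real (m P2)" "vel s' P2" "vel s P3" "vel s P2"]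
      by (simp add: coef_def)
    then have "vel s' P2 + of_real (coef m P1) * (vel s' P3 - vel s' P2)
        = vel s P2 + of_real (coef m P1) * (vel s P3 - vel s P2)"
      by algebra
    then show ?thesis using i1 vi by (simp add: gap_def)
  qed
qed

lemma collision_exists:
  assumes i: "i = P1 \<or> i = P3" and m: "m P1 > 0" "m P2 > 0" "m P3 > 0"
    and x: "norm x = 1"
    and g: "gap i (pos s) = 0" "gap i (vel s) \<noteq> 0" "gap (opp i) (pos s) \<noteq> 0"
  shows "\<exists>s'. collision m i x s s' \<and> gap i (vel s') = x * gap i (vel s)"
proof -
  define w where "w = (x - 1) * gap i (vel s)"
  define M where "M = m (opp i) + m P2"
  have M: "M > 0" using m by (cases i) (simp_all add: M_def opp_def)
  \<comment> \<open>The change \<open>w\<close> of the relative velocity is shared in inverse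
    proportion to the masses, which conserves momentum; \<open>e\<close> records that particle 2
    ends gap 3 but starts gap 1.\<close>
  define e where "e = (if i = P3 then 1 else - 1 :: complex)"
  define s' where "s' = s\<lparr>vel := (\<lambda>j. if j = i then vel s i
      else if j = P2 then vel s P2 + e * of_real (m (opp i) / M) * w
      else vel s j - e * of_real (m P2 / M) * w)\<rparr>"
  have cM: "complex_of_real M \<noteq> 0" using M by simp
  have sum1: "complex_of_real (m (opp i)) + of_real (m P2) = of_real M"
    by (simp add: M_def)
  have frac: "complex_of_real (m (opp i) / M) + of_real (m P2 / M) = 1"
    using M by (simp add: M_def flip: of_real_add add_divide_distrib)
  have mom: "complex_of_real (m P2) * of_real (m (opp i) / M) = of_real (m (opp i)) * of_real (m P2 / M)"
    by (simp flip: of_real_mult)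
  have gx: "gap i (vel s') = x * gap i (vel s)"
  proof -
    have "gap i (vel s') = gap i (vel s) + w * (of_real (m (opp i) / M) + of_real (m P2 / M))"
      using i by (auto simp: s'_def gap_def e_def algebra_simps simp del: of_real_divide)
    then show ?thesis by (simp only: frac) (simp add: w_def algebra_simps)
  qed
  have mo: "of_real (m (opp i)) * vel s' (opp i) + of_real (m P2) * vel s' P2
      = of_real (m (opp i)) * vel s (opp i) + of_real (m P2) * vel s P2"
    using i mom by (auto simp: s'_def algebra_simps opp_def simp del: of_real_divide split: if_splits)
  have mt: "\<forall>j k. meet j k s \<longleftrightarrow> j \<noteq> k \<and> j \<noteq> i \<and> k \<noteq> i"
  proof (intro allI)
    fix j k show "meet j k s \<longleftrightarrow> j \<noteq> k \<and> j \<noteq> i \<and> k \<noteq> i"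
      using g i by (cases j; cases k) (auto simp: meet_def gap_def)
  qed
  have "\<forall>j k. j \<noteq> k \<and> j \<noteq> i \<and> k \<noteq> i \<longrightarrow>
        of_real (m j) * vel s' j + of_real (m k) * vel s' k
          = of_real (m j) * vel s j + of_real (m k) * vel s k \<and>
        vel s' j - vel s' k = x * (vel s j - vel s k)"
  proof (intro allI)
    fix j k show "j \<noteq> k \<and> j \<noteq> i \<and> k \<noteq> i \<longrightarrow>
        of_real (m j) * vel s' j + of_real (m k) * vel s' k
          = of_real (m j) * vel s j + of_real (m k) * vel s k \<and>
        vel s' j - vel s' k = x * (vel s j - vel s k)"
      using i
    proof
      assume "i = P1"
      then show ?thesis using gx mo by (cases j; cases k) (auto simp: gap_def algebra_simps)
    next
      assume "i = P3"
      then show ?thesis using gx mo by (cases j; cases k) (auto simp: gap_def algebra_simps)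
    qed
  qed
  then have "collision m i x s s'"
    unfolding collision_def using mt x by (simp add: s'_def)
  with gx show ?thesis by blast
qed

text \<open>As \<open>Q\<close> and \<open>Q'\<close> are real multiples of \<open>g\<close>, so is
  \<open>P' - P\<close>; equal norms then make \<open>P'\<close> the mirror image of
  \<open>P\<close> in the line perpendicular to \<open>g\<close>. The angle to \<open>g\<close> thus
  fixes the length of this jump, and \<open>c\<close> times that length is
  \<open>norm Q + norm Q'\<close>.\<close>

lemma reflection_law:
  fixes P P' Q Q' g :: complex
  assumes n: "norm P' = norm P" and c: "c > 0"
    and eq: "Q' + of_real c * P' = Q + of_real c * P"
    and Q: "Q = of_real l * g" and Q': "Q' = - of_real l' * g"
    and l: "l \<ge> 0" "l' \<ge> 0" "l + l' > 0" and g: "g \<noteq> 0"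
    and k: "Re (P * cnj g) = - \<kappa> * norm P * norm g"
  shows "norm Q + norm Q' = 2 * c * \<kappa> * norm P" "Re (P' * cnj g) = \<kappa> * norm P' * norm g"
proof -
  define r where "r = (l + l') / c"
  have r: "r > 0" using l c by (simp add: r_def)
  have cr: "c * r = l + l'" using c by (simp add: r_def)
  have "of_real c * (P' - P) = of_real (c * r) * g"
    unfolding cr using eq Q Q' by (simp add: algebra_simps)
  then have "of_real c * P' = of_real c * (P + of_real r * g)" by (simp add: algebra_simps)
  then have P': "P' = P + of_real r * g" using c by simp
  have "(norm P')\<^sup>2 = (norm P)\<^sup>2 + 2 * r * Re (P * cnj g) + r\<^sup>2 * (norm g)\<^sup>2"
    unfolding P' cmod_power2 by (simp add: power2_eq_square algebra_simps)
  then have "r * (2 * Re (P * cnj g) + r * (norm g)\<^sup>2) = 0"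
    by (simp add: n power2_eq_square algebra_simps)
  then have h: "2 * Re (P * cnj g) = - r * (norm g)\<^sup>2" using r by simp
  have "Re (P' * cnj g) = Re (P * cnj g) + r * (norm g)\<^sup>2"
    unfolding P' cmod_power2 by (simp add: power2_eq_square algebra_simps)
  then show "Re (P' * cnj g) = \<kappa> * norm P' * norm g" using h k n by simp
  have "norm g * (r * norm g) = norm g * (2 * \<kappa> * norm P)"
    using h unfolding k by (auto simp: power2_eq_square algebra_simps)
  then have "r * norm g = 2 * \<kappa> * norm P" using g unfolding mult_cancel_left by simp
  then have "c * r * norm g = 2 * c * \<kappa> * norm P" by simp
  then show "norm Q + norm Q' = 2 * c * \<kappa> * norm P"
    using l by (simp add: Q Q' norm_mult cr algebra_simps)
qed

section \<open>Necessity: discrete Sturm comparison with a sine\<close>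

lemma sin_recurrence:
  "sin (real (Suc k) * \<psi>) = 2 * cos \<psi> * sin (real k * \<psi>) - sin ((real k - 1) * \<psi>)"
  by (simp add: algebra_simps sin_add sin_diff)

lemma sin_multiple_pos:
  assumes "k \<ge> 1" "k < N"
  shows "sin (real k * (pi / real N)) > 0"
  using assms by (intro sin_gt_zero) (auto simp: field_simps)

text \<open>\<open>p\<close>, \<open>q\<close>, \<open>q'\<close> are the speeds \<open>u k\<close>, \<open>u (k - 1)\<close>, \<open>u (k + 1)\<close>: the discrete Wronskian of the
  rescaled speeds and \<open>sin (k * \<psi>)\<close> decreases strictly.\<close>

lemma wronskian_step:
  fixes c c' \<kappa> p q q' \<psi> :: real
  assumes c: "c > 0" "c' > 0" and \<kappa>: "\<kappa> \<le> 1" and C: "sqrt (c * c') < cos \<psi>"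
    and rec: "q + q' = 2 * c * \<kappa> * p" and p: "p > 0"
    and pos: "sin (real k * \<psi>) > 0"
    and W: "sqrt c * p * sin ((real k - 1) * \<psi>) \<le> sqrt c' * q * sin (real k * \<psi>)"
  shows "sqrt c' * q' * sin (real k * \<psi>) < sqrt c * p * sin (real (Suc k) * \<psi>)"
proof -
  \<comment> \<open>Scaling by \<open>sqrt c'\<close> makes the coefficient symmetric in
    \<open>c\<close> and \<open>c'\<close>, hence the same at every collision.\<close>
  have "c = sqrt c * sqrt c" using c by simp
  then have "sqrt c' * (q + q') = sqrt c' * (2 * (sqrt c * sqrt c) * \<kappa> * p)"
    using rec by simp
  then have "sqrt c' * (q + q') = 2 * (\<kappa> * sqrt (c * c')) * (sqrt c * p)"
    by (simp only: real_sqrt_mult mult_ac)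
  then have "sqrt c' * (q + q') * sin (real k * \<psi>)
      = 2 * (\<kappa> * sqrt (c * c')) * (sqrt c * p * sin (real k * \<psi>))"
    by simp
  moreover have \<kappa>C: "\<kappa> * sqrt (c * c') < cos \<psi>"
  proof -
    have "\<kappa> * sqrt (c * c') \<le> 1 * sqrt (c * c')"
      using c by (intro mult_right_mono[OF \<kappa>]) simp
    then show ?thesis using C by simp
  qed
  have "\<kappa> * sqrt (c * c') * (sqrt c * p * sin (real k * \<psi>))
      < cos \<psi> * (sqrt c * p * sin (real k * \<psi>))"
    using c p pos by (intro mult_strict_right_mono[OF \<kappa>C]) auto
  ultimately show ?thesis
    using W by (simp only: sin_recurrence) (simp add: algebra_simps)
qed

text \<open>The \<open>k\<close>-th of \<open>N\<close> collisions leads from \<open>b\<close> to \<open>s1\<close>. In the first collision \<open>l = 0\<close>, in the later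
  ones \<open>1 / l\<close> is the time since the previous collision.\<close>

lemma no_capture:
  assumes m: "m P1 > 0" "m P2 > 0" "m P3 > 0"
    and \<kappa>: "\<kappa> \<le> 1" and C: "sqrt (coef m P1 * coef m P3) < cos \<psi>"
    and \<psi>: "\<psi> = pi / real (Suc N)"
  shows "k \<ge> 1 \<Longrightarrow> k + r = N \<Longrightarrow> i = P1 \<or> i = P3 \<Longrightarrow> collision m i x b s1 \<Longrightarrow>
    evolution m (alt (opp i) r) s1 s' \<Longrightarrow>
    gap (if even r then opp i else i) (vel s') = 0 \<Longrightarrow>
    g = gap (opp i) (pos b) \<Longrightarrow> gap (opp i) (vel b) = of_real l * g \<Longrightarrow> l \<ge> 0 \<Longrightarrow>
    l > 0 \<or> r > 0 \<Longrightarrow>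
    Re (gap i (vel b) * cnj g) = - \<kappa> * norm (gap i (vel b)) * norm g \<Longrightarrow>
    sqrt (coef m i) * norm (gap i (vel b)) * sin ((real k - 1) * \<psi>)
      \<le> sqrt (coef m (opp i)) * norm (gap (opp i) (vel b)) * sin (real k * \<psi>) \<Longrightarrow> False"
proof (induction r arbitrary: k i x b s1 g l)
  case (Suc r)
  note cd = collisionD[OF Suc.prems(4,3) m]
  from Suc.prems(5) obtain T y s2 where T: "T > 0"
    and col2: "collision m (opp i) y (drift T s1) s2"
    and ev2: "evolution m (alt (opp (opp i)) r) s2 s'"
    by (auto elim: evolution.cases)
  have oo: "opp (opp i) = i" and oi: "opp i = P1 \<or> opp i = P3" using Suc.prems(3) by auto
  note cd2 = collisionD[OF col2 oi m]
  have g0: "g \<noteq> 0" using cd(3) Suc.prems(7) by simp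
  define P' Q' where "P' = gap i (vel s1)" and "Q' = gap (opp i) (vel s1)"
  \<comment> \<open>During the flight of length \<open>T\<close> the gap \<open>g\<close> closes,
    while gap \<open>i\<close> opens from zero with velocity \<open>P'\<close>.\<close>
  have "g + of_real T * Q' = 0"
    using cd2(1) by (simp add: gap_drift cd(4) Suc.prems(7) Q'_def)
  then have Q'g: "Q' = - of_real (1 / T) * g" using T by (simp add: field_simps eq_neg_iff_add_eq_0)
  have rl: "norm (gap (opp i) (vel b)) + norm Q' = 2 * coef m i * \<kappa> * norm (gap i (vel b))"
    "Re (P' * cnj g) = \<kappa> * norm P' * norm g"
    using reflection_law[OF cd(5) coef_pos[OF m] cd(6) Suc.prems(8) Q'g[unfolded Q'_def] Suc.prems(9)
      _ _ g0 Suc.prems(11)] T Suc.prems(9) unfolding P'_def Q'_def by (simp_all add: add_nonneg_pos)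
  have g2: "gap i (pos (drift T s1)) = of_real T * P'"
    using cd(1,4) by (simp add: gap_drift P'_def)
  have n1: "norm Q' * T = norm g" using T by (simp add: Q'g norm_mult norm_divide)
  have W: "sqrt (coef m (opp i)) * norm Q' * sin (real k * \<psi>)
      \<le> sqrt (coef m i) * norm P' * sin (real (Suc k) * \<psi>)"
  proof -
    have C': "sqrt (coef m i * coef m (opp i)) < cos \<psi>"
      using C Suc.prems(3) by (auto simp: mult.commute)
    have "sin (real k * \<psi>) > 0"
      unfolding \<psi> using Suc.prems(1,2) by (intro sin_multiple_pos) auto
    from wronskian_step[OF coef_pos[OF m] coef_pos[OF m] \<kappa> C' rl(1) _ this Suc.prems(12)] cd(2,5)
    show ?thesis by (simp add: P'_def)
  qed
  show False
  proof (rule Suc.IH[OF _ _ oi col2 ev2])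
    show "1 \<le> Suc k" by simp
    show "Suc k + r = N" using Suc.prems by simp
    show "gap (if even r then opp (opp i) else opp i) (vel s') = 0"
      using Suc.prems(6) oo by auto
    show "of_real T * P' = gap (opp (opp i)) (pos (drift T s1))" using g2 oo by simp
    show "gap (opp (opp i)) (vel (drift T s1)) = of_real (1 / T) * (of_real T * P')"
      using T by (simp add: oo P'_def)
    show "0 \<le> 1 / T" "0 < 1 / T \<or> 0 < r" using T by auto
    \<comment> \<open>\<open>Q'\<close> points against \<open>g\<close> and the new gap points along
      \<open>P'\<close>, so the next collision sees the same angle and \<kappa> is
      inherited.\<close>
    have "Re (Q' * cnj (of_real T * P')) = - Re (P' * cnj g)"
      using T by (simp add: Q'g algebra_simps)
    also have "\<dots> = - \<kappa> * norm P' * (norm Q' * T)" using rl(2) n1 by simp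
    finally show "Re (gap (opp i) (vel (drift T s1)) * cnj (of_real T * P'))
      = - \<kappa> * norm (gap (opp i) (vel (drift T s1))) * norm (of_real T * P')"
      using T by (simp add: Q'_def norm_mult)
    show "sqrt (coef m (opp i)) * norm (gap (opp i) (vel (drift T s1))) * sin ((real (Suc k) - 1) * \<psi>)
      \<le> sqrt (coef m (opp (opp i))) * norm (gap (opp (opp i)) (vel (drift T s1))) * sin (real (Suc k) * \<psi>)"
      using W by (simp add: oo P'_def Q'_def)
  qed
next
  case 0
  note cd = collisionD[OF "0.prems"(4,3) m]
  have s1: "s' = s1" using "0.prems"(5) by (auto elim: evolution.cases)
  have g0: "g \<noteq> 0" using cd(3) "0.prems"(7) by simp
  define Q' where "Q' = gap (opp i) (vel s1)"
  have Q'0: "Q' = 0" using "0.prems"(6) s1 by (simp add: Q'_def)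
  \<comment> \<open>Capture gives \<open>l' = 0\<close>, so the law needs \<open>l > 0\<close>; with
    \<open>r = 0\<close> this is what the disjunction \<open>l > 0 \<or> r > 0\<close>
    supplies.\<close>
  have rl: "norm (gap (opp i) (vel b)) + norm Q' = 2 * coef m i * \<kappa> * norm (gap i (vel b))"
    using reflection_law(1)[OF cd(5) coef_pos[OF m] cd(6) "0.prems"(8) _ "0.prems"(9) _ _ g0 "0.prems"(11),
      of 0] Q'0 "0.prems"(10) unfolding Q'_def by auto
  have C': "sqrt (coef m i * coef m (opp i)) < cos \<psi>"
    using C "0.prems"(3) by (auto simp: mult.commute)
  have "sin (real k * \<psi>) > 0"
    unfolding \<psi> using "0.prems"(1,2) by (intro sin_multiple_pos) auto
  \<comment> \<open>The strict inequality would make this sine positive, but at \<open>k = N\<close>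
    its argument is \<open>pi\<close>.\<close>
  from wronskian_step[OF coef_pos[OF m] coef_pos[OF m] \<kappa> C' rl _ this "0.prems"(12)] cd(2)
  have "sin (real (Suc k) * \<psi>) \<noteq> 0" using Q'0 by auto
  then show False unfolding \<psi> using "0.prems"(2) by simp
qed

section \<open>Sufficiency: explicit capture trajectories\<close>

definition spectator :: "nat \<Rightarrow> particle" where
  "spectator k = (if odd k then P3 else P1)"

text \<open>With \<open>u\<close> as above and \<open>Re w = \<kappa>\<close>, these are the states just before and after the \<open>k\<close>-th collision
  of the explicit solution, in units where (gap) times (relative speed) is 1.\<close>

definition before_collision :: "complex \<Rightarrow> (nat \<Rightarrow> real) \<Rightarrow> nat \<Rightarrow> state \<Rightarrow> bool" where
  "before_collision w u k s \<longleftrightarrow>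
     gap (spectator k) (pos s) = 0 \<and>
     gap (opp (spectator k)) (pos s) = w ^ k / of_real (u k) \<and>
     gap (spectator k) (vel s) = - (w ^ (k - 1) * of_real (u k)) \<and>
     gap (opp (spectator k)) (vel s) = w ^ k * of_real (u (k - 1))"

definition after_collision :: "complex \<Rightarrow> (nat \<Rightarrow> real) \<Rightarrow> nat \<Rightarrow> state \<Rightarrow> bool" where
  "after_collision w u k s \<longleftrightarrow>
     gap (spectator k) (pos s) = 0 \<and>
     gap (opp (spectator k)) (pos s) = w ^ k / of_real (u k) \<and>
     gap (spectator k) (vel s) = w ^ Suc k * of_real (u k) \<and>
     gap (opp (spectator k)) (vel s) = - (w ^ k * of_real (u (Suc k)))"

lemma spectator_Suc: "spectator (Suc k) = opp (spectator k)"
  by (simp add: spectator_def)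

lemma opp_opp_spectator [simp]: "opp (opp (spectator k)) = spectator k"
  by (simp add: spectator_def)

lemma spectator_cases: "spectator k = P1 \<or> spectator k = P3"
  by (simp add: spectator_def)

lemma unit_add_cnj:
  assumes "norm w = 1"
  shows "w\<^sup>2 + 1 = of_real (2 * Re w) * w"
proof -
  have "w * cnj w = 1" using assms by (simp add: complex_norm_square[symmetric])
  then have "w\<^sup>2 + 1 = w * (w + cnj w)" by (simp add: power2_eq_square algebra_simps)
  then show ?thesis by (simp add: complex_add_cnj)
qed

text \<open>The factor \<open>- (w\<^sup>2)\<close> turns the direction
  \<open>- (w ^ (k - 1))\<close> into \<open>w ^ Suc k\<close>. By \<open>unit_add_cnj\<close> the
  resulting jump of the other gap's velocity lies along \<open>w ^ k\<close>, and the recurrence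
  gives its new speed as \<open>u (Suc k)\<close>.\<close>

lemma collide:
  assumes b: "before_collision w u k s" and k: "k \<ge> 1" "u k > 0"
    and m: "m P1 > 0" "m P2 > 0" "m P3 > 0" and w: "norm w = 1"
    and rec: "u (k - 1) + u (Suc k) = 2 * coef m (spectator k) * Re w * u k"
  shows "\<exists>s'. collision m (spectator k) (- (w\<^sup>2)) s s' \<and> after_collision w u k s'"
proof -
  let ?i = "spectator k"
  obtain j where j: "k = Suc j" using k by (cases k) auto
  have w0: "w \<noteq> 0" using w by auto
  note b = b[unfolded before_collision_def]
  have "\<exists>s'. collision m ?i (- (w\<^sup>2)) s s' \<and> gap ?i (vel s') = - (w\<^sup>2) * gap ?i (vel s)"
    using b k w w0 by (intro collision_exists[OF spectator_cases m]) (auto simp: norm_power)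
  then obtain s' where col: "collision m ?i (- (w\<^sup>2)) s s'"
    and g: "gap ?i (vel s') = - (w\<^sup>2) * gap ?i (vel s)" by blast
  have g': "gap ?i (vel s') = w ^ Suc k * of_real (u k)"
    using b g by (simp add: j power2_eq_square)
  note cd = collisionD[OF col spectator_cases m]
  have "gap (opp ?i) (vel s') = w ^ k * of_real (u (k - 1))
      - of_real (coef m ?i * u k) * (w ^ j * (w\<^sup>2 + 1))"
    using cd(6) b g' by (simp add: j power2_eq_square algebra_simps)
  also have "\<dots> = w ^ k * of_real (u (k - 1) - 2 * coef m ?i * Re w * u k)"
    unfolding unit_add_cnj[OF w] by (simp add: j algebra_simps)
  also have "\<dots> = - (w ^ k * of_real (u (Suc k)))"
    by (simp only: rec[symmetric]) (simp add: algebra_simps)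
  finally have "after_collision w u k s'"
    unfolding after_collision_def using b cd(4) g' by simp
  with col show ?thesis by blast
qed

text \<open>Divided by \<open>w ^ k\<close>, the gaps are a positive multiple of \<open>w\<close>
  and a positive real, so their sum has positive real part. For \<open>u (Suc k) = 0\<close> the
  bound on \<open>t\<close> is vacuous, which covers the flight after the capture.\<close>

lemma no_meet_after:
  assumes a: "after_collision w u k s" and u: "u k > 0" "u (Suc k) \<ge> 0"
    and w: "norm w = 1" "Re w > 0" and t: "t > 0" "t * u k * u (Suc k) < 1"
  shows "\<not> meet j l (drift t s)"
proof -
  let ?i = "spectator k"
  have w0: "w \<noteq> 0" using w by auto
  define r where "r = 1 / u k - t * u (Suc k)"
  have "u k * r > 0" using u t by (simp add: r_def algebra_simps)
  then have r: "r > 0" using u by (simp add: zero_less_mult_iff)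
  have g1: "gap ?i (pos (drift t s)) = w ^ k * (of_real (t * u k) * w)"
    using a by (simp add: after_collision_def gap_drift)
  have g2: "gap (opp ?i) (pos (drift t s)) = w ^ k * of_real r"
    using a by (simp add: after_collision_def gap_drift r_def algebra_simps)
  have "Re (of_real (t * u k) * w + of_real r) > 0"
    using t u w r by (simp add: add_pos_pos)
  then have "of_real (t * u k) * w + of_real r \<noteq> 0" by (metis less_irrefl zero_complex.simps(1))
  then have n3: "gap ?i (pos (drift t s)) + gap (opp ?i) (pos (drift t s)) \<noteq> 0"
    using w0 unfolding g1 g2 distrib_left[symmetric] by simp
  have "gap ?i (pos (drift t s)) \<noteq> 0" "gap (opp ?i) (pos (drift t s)) \<noteq> 0"
    unfolding g1 g2 using w0 t u r by auto
  with n3 show ?thesis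
    using spectator_cases[of k] by (intro no_meet) (auto simp: add.commute)
qed

text \<open>A gap of length \<open>1 / u k\<close> closes at speed \<open>u (Suc k)\<close>, while
  the other one opens at speed \<open>u k\<close> to length \<open>1 / u (Suc k)\<close>.\<close>

lemma fly:
  assumes a: "after_collision w u k s" and u: "u k > 0" "u (Suc k) > 0"
  shows "before_collision w u (Suc k) (drift (1 / (u k * u (Suc k))) s)"
  using assms unfolding after_collision_def before_collision_def
  by (simp add: spectator_Suc gap_drift)

lemma evolution_exists:
  assumes m: "m P1 > 0" "m P2 > 0" "m P3 > 0" and w: "norm w = 1" "Re w > 0"
    and u: "\<And>k. 1 \<le> k \<Longrightarrow> k \<le> N \<Longrightarrow> u k > 0"
    and rec: "\<And>k. 1 \<le> k \<Longrightarrow> u (k - 1) + u (Suc k) = 2 * coef m (spectator k) * Re w * u k"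
  shows "after_collision w u k s \<Longrightarrow> 1 \<le> k \<Longrightarrow> k + r = N \<Longrightarrow>
    \<exists>s'. evolution m (alt (opp (spectator k)) r) s s' \<and> after_collision w u N s'"
proof (induction r arbitrary: k s)
  case 0
  then show ?case by (auto intro: evolution.Nil)
next
  case (Suc r)
  define T where "T = 1 / (u k * u (Suc k))"
  have uk: "u k > 0" "u (Suc k) > 0" using u Suc.prems by auto
  then have T: "T > 0" "T * u k * u (Suc k) = 1" by (simp_all add: T_def)
  have "before_collision w u (Suc k) (drift T s)"
    unfolding T_def by (rule fly[OF Suc.prems(1) uk])
  then obtain s1 where s1: "collision m (opp (spectator k)) (- (w\<^sup>2)) (drift T s) s1"
    "after_collision w u (Suc k) s1"
    using collide[OF _ _ uk(2) m w(1) rec] by (auto simp: spectator_Suc)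
  obtain s' where s': "evolution m (alt (opp (spectator (Suc k))) r) s1 s'" "after_collision w u N s'"
    using Suc.IH[OF s1(2)] Suc.prems by auto
  have "\<not> meet j l (drift t s)" if "t \<in> {0<..<T}" for t j l
  proof (rule no_meet_after[OF Suc.prems(1) uk(1) _ w])
    have "t * (u k * u (Suc k)) < T * (u k * u (Suc k))"
      using that uk by (intro mult_strict_right_mono) auto
    then show "t * u k * u (Suc k) < 1" using T by (simp add: mult.assoc)
  qed (use that uk in auto)
  then have "evolution m (opp (spectator k) # alt (opp (opp (spectator k))) r) s s'"
    using T s1(1) s'(1) by (intro evolution.Cons[where \<tau> = T]) (auto simp: spectator_Suc)
  then show ?case using s'(2) by auto
qed

lemma capture_exists:
  fixes n :: nat
  assumes n: "n \<ge> 1" and m: "m P1 > 0" "m P2 > 0" "m P3 > 0" and w: "norm w = 1" "Re w > 0"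
    and u: "\<And>k. 1 \<le> k \<Longrightarrow> k \<le> 2 * n \<Longrightarrow> u k > 0" and u0: "u 0 = 0" "u (Suc (2 * n)) = 0"
    and rec: "\<And>k. 1 \<le> k \<Longrightarrow> u (k - 1) + u (Suc k) = 2 * coef m (spectator k) * Re w * u k"
  shows "capture_allowed m (alt P3 (2 * n))"
proof -
  \<comment> \<open>Particle 1 reaches particle 2 after unit time; particles 2 and 3 being at rest
    matches \<open>u 0 = 0\<close>.\<close>
  define s where "s = \<lparr>pos = (\<lambda>i. if i = P1 then - of_real (u 1) else if i = P2 then 0 else w / of_real (u 1)),
    vel = (\<lambda>i. if i = P1 then complex_of_real (u 1) else 0)\<rparr>"
  have u1: "u 1 > 0" using u n by auto
  have w0: "w \<noteq> 0" using w by auto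
  have sp1: "spectator (Suc 0) = P3" by (simp add: spectator_def)
  have b: "before_collision w u 1 (drift 1 s)"
    using u0 by (simp add: before_collision_def sp1 gap_drift) (simp add: s_def gap_def)
  obtain s1 where s1: "collision m P3 (- (w\<^sup>2)) (drift 1 s) s1" "after_collision w u 1 s1"
    using collide[OF b _ u1 m w(1) rec] sp1 by auto
  obtain s' where s': "evolution m (alt P1 (2 * n - 1)) s1 s'" "after_collision w u (2 * n) s'"
    using evolution_exists[OF m w u rec s1(2), where r = "2 * n - 1"] n sp1 by auto
  have "\<not> meet j l (drift t s)" if t: "t \<in> {0<..<1}" for t j l
  proof (rule no_meet)
    have g: "gap P1 (pos (drift t s)) = w / of_real (u 1)"
      "gap P3 (pos (drift t s)) = of_real ((1 - t) * u 1)"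
      by (simp_all add: gap_drift) (simp_all add: s_def gap_def algebra_simps)
    show "gap P1 (pos (drift t s)) \<noteq> 0" "gap P3 (pos (drift t s)) \<noteq> 0"
      unfolding g using u1 w0 t by auto
    have "Re (w / of_real (u 1) + of_real ((1 - t) * u 1)) > 0"
      using t u1 w by (simp add: add_pos_pos)
    then show "gap P1 (pos (drift t s)) + gap P3 (pos (drift t s)) \<noteq> 0"
      unfolding g by (metis less_irrefl zero_complex.simps(1))
  qed
  then have "evolution m (P3 # alt P1 (2 * n - 1)) s s'"
    using s1(1) s'(1) by (intro evolution.Cons[where \<tau> = 1]) auto
  moreover have "P3 # alt P1 (2 * n - 1) = alt P3 (2 * n)"
    using n by (cases "2 * n") auto
  moreover have "\<not> meet j l (drift t s')" if "t > 0" for t j l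
    by (rule no_meet_after[OF s'(2) _ _ w that]) (use u u0 n in auto)
  moreover have "vel s' P1 = vel s' P2"
    using s'(2) u0 by (simp add: after_collision_def spectator_def gap_def)
  ultimately show ?thesis
    unfolding capture_allowed_def using u1 w0
    by (intro exI[of _ s] exI[of _ s']) (auto simp: s_def)
qed

section \<open>The threshold for the cosine\<close>

lemma capture_sufficient:
  fixes n :: nat
  assumes n: "n \<ge> 1" and m: "m P1 > 0" "m P2 > 0" "m P3 > 0"
    and C: "cos (pi / real (2 * n + 1)) \<le> sqrt (coef m P1 * coef m P3)"
  shows "capture_allowed m (alt P3 (2 * n))"
proof -
  define \<psi> where "\<psi> = pi / real (2 * n + 1)"
  define c where "c i = sqrt (coef m i)" for i
  define \<kappa> where "\<kappa> = cos \<psi> / (c P1 * c P3)"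
  define w where "w = Complex \<kappa> (sqrt (1 - \<kappa>\<^sup>2))"
  \<comment> \<open>Dividing by \<open>c\<close> undoes the rescaling of the speeds, so the
    recurrence reduces to the one for sines.\<close>
  define u where "u k = sin (real k * \<psi>) / c (spectator k)" for k
  have c: "c i > 0" "(c i)\<^sup>2 = coef m i" for i
    using coef_pos[OF m, of i] by (simp_all add: c_def)
  \<comment> \<open>Here \<open>n \<ge> 1\<close> enters: it yields \<open>Re w > 0\<close>, which
    keeps particles 1 and 3 apart.\<close>
  have "\<psi> \<le> pi / 3" unfolding \<psi>_def using n by (intro divide_left_mono) auto
  moreover have "\<psi> > 0" by (simp add: \<psi>_def)
  ultimately have "cos \<psi> > 0" using pi_gt_zero by (intro cos_gt_zero) linarith+
  then have \<kappa>: "\<kappa> > 0" using c(1) by (simp add: \<kappa>_def)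
  have "cos \<psi> \<le> c P1 * c P3" using C by (simp add: \<psi>_def c_def real_sqrt_mult)
  then have "\<kappa> \<le> 1" using c(1) by (simp add: \<kappa>_def)
  then have "\<kappa>\<^sup>2 \<le> 1" using \<kappa> by (simp add: power_le_one)
  then have w: "norm w = 1" by (simp add: w_def cmod_def)
  have co: "c (spectator k) * c (opp (spectator k)) = c P1 * c P3" for k
    by (simp add: spectator_def)
  have rec: "u (k - 1) + u (Suc k) = 2 * coef m (spectator k) * Re w * u k" if k: "1 \<le> k" for k
  proof -
    have sp: "spectator (k - 1) = opp (spectator k)"
      using spectator_Suc[of "k - 1"] k by simp
    have "u (k - 1) = sin ((real k - 1) * \<psi>) / c (opp (spectator k))"
      using k by (simp only: u_def sp of_nat_diff of_nat_1)
    then have "u (k - 1) + u (Suc k) = 2 * cos \<psi> * sin (real k * \<psi>) / c (opp (spectator k))"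
      by (simp add: u_def spectator_Suc sin_recurrence diff_divide_distrib del: of_nat_Suc)
    also have "\<dots> = 2 * coef m (spectator k) * \<kappa> * u k"
      using c(1)[of "spectator k"] c(1)[of "opp (spectator k)"]
      by (simp add: u_def \<kappa>_def flip: c(2) co[of k]) (simp add: power2_eq_square field_simps)
    finally show ?thesis by (simp add: w_def)
  qed
  show ?thesis
  proof (rule capture_exists[OF n m w _ _ _ _ rec])
    show "u k > 0" if "1 \<le> k" "k \<le> 2 * n" for k
      using sin_multiple_pos[of k "2 * n + 1"] that c(1) by (simp add: u_def \<psi>_def)
    have "real (Suc (2 * n)) * \<psi> = pi" unfolding \<psi>_def by (simp add: field_simps)
    then show "u (Suc (2 * n)) = 0" by (simp add: u_def del: of_nat_Suc)
  qed (use \<kappa> in \<open>auto simp: w_def u_def\<close>)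
qed

lemma capture_necessary:
  fixes n :: nat
  assumes n: "n \<ge> 1" and m: "m P1 > 0" "m P2 > 0" "m P3 > 0"
    and cap: "capture_allowed m (alt P3 (2 * n))"
  shows "cos (pi / real (2 * n + 1)) \<le> sqrt (coef m P1 * coef m P3)"
proof (rule ccontr)
  assume "\<not> ?thesis"
  then have C: "sqrt (coef m P1 * coef m P3) < cos (pi / real (Suc (2 * n)))" by simp
  obtain s s' where s: "vel s P2 = 0" "vel s P3 = 0" and ev: "evolution m (alt P3 (2 * n)) s s'"
    and fin: "vel s' P1 = vel s' P2"
    using cap unfolding capture_allowed_def by blast
  have al: "alt P3 (2 * n) = P3 # alt P1 (2 * n - 1)" using n by (cases "2 * n") auto
  from ev obtain T x s1 where col: "collision m P3 x (drift T s) s1"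
    and ev1: "evolution m (alt P1 (2 * n - 1)) s1 s'"
    unfolding al by (auto elim: evolution.cases)
  note cd = collisionD[OF col _ m, simplified]
  define g where "g = gap P1 (pos (drift T s))"
  define P where "P = gap P3 (vel s)"
  \<comment> \<open>The first collision fixes \<kappa> as the cosine of the angle between
    \<open>- P\<close> and \<open>g\<close>.\<close>
  define \<kappa> where "\<kappa> = - Re (P * cnj g) / (norm P * norm g)"
  have P: "P \<noteq> 0" and g: "g \<noteq> 0" using cd(2,3) by (simp_all add: P_def g_def)
  have "- Re (P * cnj g) \<le> norm (P * cnj g)"
    using abs_Re_le_cmod[of "P * cnj g"] by linarith
  then have \<kappa>: "\<kappa> \<le> 1" using P g by (simp add: \<kappa>_def norm_mult)
  \<comment> \<open>Particles 2 and 3 start at rest, so \<open>l = 0\<close>, and the initial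
    Wronskian inequality reads \<open>0 \<le> 0\<close>.\<close>
  show False
  proof (rule no_capture[OF m \<kappa> C refl, where k = 1 and r = "2 * n - 1" and l = 0])
    show "collision m P3 x (drift T s) s1" by (fact col)
    show "evolution m (alt (opp P3) (2 * n - 1)) s1 s'" using ev1 by simp
    show "gap (if even (2 * n - 1) then opp P3 else P3) (vel s') = 0"
      using fin n by (simp add: gap_def)
    show "Re (gap P3 (vel (drift T s)) * cnj g) = - \<kappa> * norm (gap P3 (vel (drift T s))) * norm g"
      using P g by (simp add: \<kappa>_def flip: P_def)
  qed (use n s in \<open>auto simp: g_def gap_def\<close>)
qed

theorem mainTheorem4:
  fixes n :: nat and a b :: real and m :: "particle \<Rightarrow> real"
  assumes "n \<ge> 1"
    and "m P1 > 0" and "m P2 > 0" and "m P3 > 0"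
    and "a = m P1 / m P2" and "b = m P3 / m P2"
  shows "capture_allowed m (concat (replicate n [P3, P1])) \<longleftrightarrow>
    a * b * (cot ((2 * real n - 1) * pi / (2 * (2 * real n + 1))))\<^sup>2 - a - b - 1 \<ge> 0"
proof -
  define \<psi> where "\<psi> = pi / real (2 * n + 1)"
  have "\<psi> \<le> pi / 3" unfolding \<psi>_def using assms(1) by (intro divide_left_mono) auto
  moreover have "\<psi> > 0" by (simp add: \<psi>_def)
  ultimately have cp: "cos \<psi> > 0" using pi_gt_zero by (intro cos_gt_zero) linarith+
  \<comment> \<open>The angle in the theorem is complementary to \<psi>, so its cotangent is the
    tangent of \<psi>.\<close>
  have "(2 * real n - 1) * pi / (2 * (2 * real n + 1)) = pi / 2 - \<psi>"
    unfolding \<psi>_def by (simp add: field_simps)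
  then have ct: "cot ((2 * real n - 1) * pi / (2 * (2 * real n + 1))) = sin \<psi> / cos \<psi>"
    by (simp add: cot_def sin_diff cos_diff)
  have ab: "a > 0" "b > 0" using assms by simp_all
  have co: "coef m P1 * coef m P3 = a * b / ((a + 1) * (b + 1))"
    using assms(2-4) by (simp add: coef_def assms(5,6) divide_simps)
  have "capture_allowed m (concat (replicate n [P3, P1])) \<longleftrightarrow> cos \<psi> \<le> sqrt (coef m P1 * coef m P3)"
    unfolding concat_replicate_eq_alt \<psi>_def
    using capture_sufficient[OF assms(1-4)] capture_necessary[OF assms(1-4)] by blast
  also have "\<dots> \<longleftrightarrow> (cos \<psi>)\<^sup>2 \<le> a * b / ((a + 1) * (b + 1))"
    unfolding co using cp by (simp flip: real_sqrt_le_iff[of "(cos \<psi>)\<^sup>2"])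
  also have "\<dots> \<longleftrightarrow> (cos \<psi>)\<^sup>2 * ((a + 1) * (b + 1)) \<le> a * b"
    using ab by (simp add: pos_le_divide_eq)
  also have "\<dots> \<longleftrightarrow> (a + b + 1) * (cos \<psi>)\<^sup>2 \<le> a * b * (sin \<psi>)\<^sup>2"
    by (simp add: sin_squared_eq algebra_simps)
  also have "\<dots> \<longleftrightarrow> a + b + 1 \<le> a * b * (sin \<psi> / cos \<psi>)\<^sup>2"
    using cp by (simp add: power_divide pos_le_divide_eq)
  finally show ?thesis unfolding ct by (simp add: algebra_simps)
qed

end
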